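(* A Möbius transformation $f\in\mathrm{PSL}(2,\mathbb{R})$, viewed as a diffeomorphism of the circle, has positive asymptotic distortion if and only if it is hyperbolic.
   Context: $\mathrm{PSL}(2,\mathbb{R})$ acts by orientation-preserving isometries on the Poincaré disk, and hence by real-analytic diffeomorphisms on its boundary circle $\mathrm{S}^1$ (parametrized by the angle); explicitly these are the maps $e^{i\theta}\mapsto e^{i\alpha}\frac{e^{i\theta}-a}{1-\bar a e^{i\theta}}$ with $\alpha\in\mathbb{R}$, $a\in\mathbb{C}$, $|a|<1$. An element is hyperbolic if the absolute value of the trace of a matrix representing it is greater than $2$. For a diffeomorphism $f$ of the circle such that $\log(Df)$ has finite total variation, the asymptotic distortion is $$\mathrm{dist}_\infty(f):=\lim_{n\to\infty}\frac{\mathrm{var}(\log(Df^n))}{n},$$ where $f^n$ is the $n$-th iterate and $\mathrm{var}$ denotes total variation on the circle; the limit exists by subadditivity. *)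

theory Defs
  imports
    "HOL-Complex_Analysis.Riemann_Mapping"
    "HOL-Algebra.Coset"
begin

definition SL2R :: "(real^2^2) monoid" where
  "SL2R = \<lparr>carrier = {A. det A = 1}, mult = (**), one = mat 1\<rparr>"

text \<open>An element of \<open>PSL2R\<close> is a coset \<open>{A, - A}\<close>.\<close>

definition PSL2R :: "(real^2^2) set monoid" where
  "PSL2R = SL2R Mod {mat 1, - mat 1}"

definition hyperbolic :: "(real^2^2) set \<Rightarrow> bool" where
  "hyperbolic f \<longleftrightarrow> (\<exists>A\<in>f. \<bar>trace A\<bar> > 2)"

text \<open>
  Conjugating the action of a real matrix \<open>(a b; c d)\<close> of determinant 1 on the upper
  half-plane by the Cayley transform \<open>z \<mapsto> (z - \<i>) / (z + \<i>)\<close> gives the action of the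
  matrix \<open>(\<alpha> \<beta>; cnj \<beta> cnj \<alpha>)\<close> on the Poincare disk (lemma \<open>disk_map_cayley\<close>);
  the formula makes sense on the closed disk.
\<close>

definition SU_alpha :: "real^2^2 \<Rightarrow> complex" where
  "SU_alpha A = Complex ((A$1$1 + A$2$2) / 2) ((A$1$2 - A$2$1) / 2)"

definition SU_beta :: "real^2^2 \<Rightarrow> complex" where
  "SU_beta A = Complex ((A$1$1 - A$2$2) / 2) (- (A$1$2 + A$2$1) / 2)"

definition disk_map :: "real^2^2 \<Rightarrow> complex \<Rightarrow> complex" where
  "disk_map A z = (SU_alpha A * z + SU_beta A) / (cnj (SU_beta A) * z + cnj (SU_alpha A))"

text \<open>The value does not depend on the representative, see \<open>psl_action_eq\<close>.\<close>

definition psl_action :: "(real^2^2) set \<Rightarrow> complex \<Rightarrow> complex" where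
  "psl_action f z = (THE w. \<exists>A\<in>f. w = disk_map A z)"

text \<open>
  A self-map of the unit circle is represented by a function on the complex plane of which only
  the values on the unit circle matter; functions on the circle with real values
  are \<open>2 * pi\<close>-periodic functions of the angle.
\<close>

definition circle_lift :: "(complex \<Rightarrow> complex) \<Rightarrow> (real \<Rightarrow> real) \<Rightarrow> bool" where
  "circle_lift f F \<longleftrightarrow> continuous_on UNIV F \<and> (\<forall>t. f (cis t) = cis (F t))"

definition circle_deriv :: "(complex \<Rightarrow> complex) \<Rightarrow> real \<Rightarrow> real" where
  "circle_deriv f \<theta> = (THE D. \<exists>F. circle_lift f F \<and> (F has_real_derivative D) (at \<theta>))"

text \<open>
  Total variation on the circle: the supremum over all cyclic subdivisions
  \<open>t 0 \<le> t 1 \<le> \<dots> \<le> t n = t 0 + 2 * pi\<close>.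
\<close>

definition circle_var :: "(real \<Rightarrow> real) \<Rightarrow> ereal" where
  "circle_var \<phi> =
     (SUP (n, t) \<in> {(n :: nat, t :: nat \<Rightarrow> real). (\<forall>i<n. t i \<le> t (Suc i)) \<and> t n = t 0 + 2 * pi}.
        ereal (\<Sum>i<n. \<bar>\<phi> (t (Suc i)) - \<phi> (t i)\<bar>))"

definition dist_infty :: "(complex \<Rightarrow> complex) \<Rightarrow> ereal" where
  "dist_infty f = lim (\<lambda>n. circle_var (\<lambda>\<theta>. ln (circle_deriv (f ^^ n) \<theta>)) / ereal (real n))"


lemma mat2_eq_iff:
  fixes A B :: "real^2^2"
  shows "A = B \<longleftrightarrow> A$1$1 = B$1$1 \<and> A$1$2 = B$1$2 \<and> A$2$1 = B$2$1 \<and> A$2$2 = B$2$2"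
  by (auto simp: vec_eq_iff forall_2)

lemma minus_matrix_mult:
  fixes A B :: "real^2^2"
  shows "(- A) ** B = - (A ** B)" "A ** (- B) = - (A ** B)"
  by (simp_all add: mat2_eq_iff matrix_matrix_mult_def sum_2)

lemma det_minus_2: "det (- A :: real^2^2) = det A"
  by (simp add: det_2)

lemma group_SL2R: "group SL2R"
proof (rule groupI)
  fix A assume "A \<in> carrier SL2R"
  then have A: "det A = 1" by (simp add: SL2R_def)
  then have inv: "invertible A" by (simp add: invertible_det_nz)
  then obtain B where "B ** A = mat 1" by (auto simp: invertible_def)
  moreover from this have "det B = 1"
    using A by (metis det_I det_mul mult.right_neutral)
  ultimately show "\<exists>B\<in>carrier SL2R. B \<otimes>\<^bsub>SL2R\<^esub> A = \<one>\<^bsub>SL2R\<^esub>"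
    by (auto simp: SL2R_def)
qed (auto simp: SL2R_def det_mul matrix_mul_assoc)

lemma normal_pm_one: "{mat 1, - mat 1} \<lhd> SL2R"
proof -
  interpret group SL2R by (rule group_SL2R)
  have sub: "subgroup {mat 1, - mat 1} SL2R"
  proof (rule subgroupI)
    fix a :: "real^2^2" assume a: "a \<in> {mat 1, - mat 1}"
    have "inv\<^bsub>SL2R\<^esub> a = a"
      by (rule inv_equality) (use a in \<open>auto simp: SL2R_def minus_matrix_mult det_minus_2\<close>)
    then show "inv\<^bsub>SL2R\<^esub> a \<in> {mat 1, - mat 1}" using a by simp
  qed (auto simp: SL2R_def minus_matrix_mult det_minus_2)
  show ?thesis
    by (rule normalI[OF sub]) (auto simp: r_coset_def l_coset_def SL2R_def minus_matrix_mult)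
qed

lemma group_PSL2R: "group PSL2R"
  unfolding PSL2R_def by (rule normal.factorgroup_is_group[OF normal_pm_one])

lemma carrier_PSL2R: "carrier PSL2R = {{A, - A} | A. det A = 1}"
  by (auto simp: PSL2R_def FactGroup_def RCOSETS_def r_coset_def SL2R_def minus_matrix_mult
        insert_commute)

lemma hyperbolic_iff: "hyperbolic {A, - A} \<longleftrightarrow> \<bar>trace A\<bar> > 2"
  by (auto simp: hyperbolic_def trace_def sum_2)

lemma SU_minus: "SU_alpha (- A) = - SU_alpha A" "SU_beta (- A) = - SU_beta A"
  by (simp_all add: SU_alpha_def SU_beta_def complex_eq_iff field_simps)

lemma disk_map_minus: "disk_map (- A) z = disk_map A z"
proof -
  have "disk_map (- A) z = (- (SU_alpha A * z + SU_beta A)) /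
          (- (cnj (SU_beta A) * z + cnj (SU_alpha A)))"
    by (simp add: disk_map_def SU_minus algebra_simps)
  also have "\<dots> = disk_map A z"
    unfolding disk_map_def by (rule minus_divide_divide)
  finally show ?thesis .
qed

lemma psl_action_eq: "psl_action {A, - A} z = disk_map A z"
  by (auto simp: psl_action_def disk_map_minus)

lemma SU_norm:
  assumes "det A = 1"
  shows "(norm (SU_alpha A))\<^sup>2 - (norm (SU_beta A))\<^sup>2 = 1"
  using assms
  unfolding SU_alpha_def SU_beta_def cmod_power2 det_2
  by (simp add: power2_eq_square field_simps)

lemma disk_map_cayley:
  assumes "det A = 1" "Im z > 0"
  defines "w \<equiv> (of_real (A$1$1) * z + of_real (A$1$2)) / (of_real (A$2$1) * z + of_real (A$2$2))"
  shows "disk_map A ((z - \<i>) / (z + \<i>)) = (w - \<i>) / (w + \<i>)"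
proof -
  define a b c d where "a = complex_of_real (A$1$1)" "b = complex_of_real (A$1$2)"
    "c = complex_of_real (A$2$1)" "d = complex_of_real (A$2$2)"
  note abcd = this
  have al: "2 * SU_alpha A = (a + d) + \<i> * (b - c)" "2 * SU_beta A = (a - d) - \<i> * (b + c)"
    "2 * cnj (SU_alpha A) = (a + d) - \<i> * (b - c)" "2 * cnj (SU_beta A) = (a - d) + \<i> * (b + c)"
    by (simp_all add: SU_alpha_def SU_beta_def abcd complex_eq_iff field_simps)
  have zi: "z + \<i> \<noteq> 0"
    using assms(2) by (auto simp: complex_eq_iff)
  have den: "c * z + d \<noteq> 0"
  proof
    assume 0: "c * z + d = 0"
    have "A$2$1 * Im z = 0" "A$2$1 * Re z + A$2$2 = 0"
      using 0 by (auto simp: abcd complex_eq_iff)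
    with assms show False by (auto simp: det_2)
  qed
  have w: "w * (c * z + d) = a * z + b"
    unfolding w_def abcd[symmetric] using den by simp
  have "(w - \<i>) / (w + \<i>) = ((w - \<i>) * (c * z + d)) / ((w + \<i>) * (c * z + d))"
    using den by simp
  also have "(w - \<i>) * (c * z + d) = a * z + b - \<i> * (c * z + d)"
    by (simp only: w left_diff_distrib)
  also have "(w + \<i>) * (c * z + d) = a * z + b + \<i> * (c * z + d)"
    by (simp only: w distrib_right[of w])
  finally have rhs: "(w - \<i>) / (w + \<i>) =
    (a * z + b - \<i> * (c * z + d)) / (a * z + b + \<i> * (c * z + d))" .
  define N where "N = SU_alpha A * ((z - \<i>) / (z + \<i>)) + SU_beta A"
  define M where "M = cnj (SU_beta A) * ((z - \<i>) / (z + \<i>)) + cnj (SU_alpha A)"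
  have ii: "\<i> * (\<i> * x) = - x" for x by (simp flip: mult.assoc)
  have "2 * (z + \<i>) * N = (2 * SU_alpha A) * (z - \<i>) + (2 * SU_beta A) * (z + \<i>)"
    unfolding N_def using zi by (simp add: field_simps)
  also have "\<dots> = 2 * (a * z + b - \<i> * (c * z + d))"
    unfolding al by (simp add: algebra_simps ii)
  finally have N: "(z + \<i>) * N = a * z + b - \<i> * (c * z + d)"
    unfolding mult.assoc by (rule mult_left_cancel[THEN iffD1, rotated]) simp
  have "2 * (z + \<i>) * M = (2 * cnj (SU_beta A)) * (z - \<i>) + (2 * cnj (SU_alpha A)) * (z + \<i>)"
    unfolding M_def using zi by (simp add: field_simps)
  also have "\<dots> = 2 * (a * z + b + \<i> * (c * z + d))"
    unfolding al by (simp add: algebra_simps ii)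
  finally have M: "(z + \<i>) * M = a * z + b + \<i> * (c * z + d)"
    unfolding mult.assoc by (rule mult_left_cancel[THEN iffD1, rotated]) simp
  have "disk_map A ((z - \<i>) / (z + \<i>)) = ((z + \<i>) * N) / ((z + \<i>) * M)"
    unfolding disk_map_def N_def[symmetric] M_def[symmetric] using zi by simp
  then show ?thesis unfolding rhs N M .
qed

lemma disk_map_Moebius_function:
  assumes "det A = 1"
  shows "\<exists>t w. norm w < 1 \<and> disk_map A = Moebius_function t w"
proof -
  define \<alpha> \<beta> where "\<alpha> = SU_alpha A" "\<beta> = SU_beta A"
  note ab = this
  have n: "(norm \<alpha>)\<^sup>2 - (norm \<beta>)\<^sup>2 = 1" using SU_norm[OF assms] by (simp add: ab)
  then have "(norm \<beta>)\<^sup>2 < (norm \<alpha>)\<^sup>2" by linarith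
  then have lt: "norm \<beta> < norm \<alpha>" by (rule power_less_imp_less_base) simp
  then have nz: "\<alpha> \<noteq> 0" by auto
  define w where "w = - \<beta> / \<alpha>"
  have w: "norm w < 1" using lt nz by (simp add: w_def norm_divide)
  have "norm (\<alpha> / cnj \<alpha>) = 1" using nz by (simp add: norm_divide)
  then obtain t where t: "\<alpha> / cnj \<alpha> = exp (\<i> * of_real t)"
    by (metis complex_norm_eq_1_exp_eq mult.commute norm_one div_by_1 norm_eq_zero
        complex_norm_eq_1_exp)
  have "disk_map A z = Moebius_function t w z" for z
  proof -
    have 1: "\<alpha> * z + \<beta> = \<alpha> * (z - w)" using nz by (simp add: w_def algebra_simps)
    have 2: "cnj \<beta> * z + cnj \<alpha> = cnj \<alpha> * (1 - cnj w * z)"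
      using nz by (simp add: w_def algebra_simps)
    have "disk_map A z = (\<alpha> * (z - w)) / (cnj \<alpha> * (1 - cnj w * z))"
      unfolding disk_map_def ab[symmetric] 1 2 ..
    also have "\<dots> = \<alpha> / cnj \<alpha> * (z - w) / (1 - cnj w * z)" by simp
    finally show ?thesis unfolding Moebius_function_def t .
  qed
  with w show ?thesis by blast
qed

lemma Moebius_function_disk_map:
  assumes "norm w < 1"
  shows "\<exists>A. det A = 1 \<and> disk_map A = Moebius_function t w"
proof -
  define s where "s = sqrt (1 - (norm w)\<^sup>2)"
  have lt: "(norm w)\<^sup>2 < 1" using assms by (simp add: power_less_one_iff)
  then have s: "s > 0" "s\<^sup>2 = 1 - (norm w)\<^sup>2" by (auto simp: s_def)
  define \<alpha> where "\<alpha> = exp (\<i> * of_real (t / 2)) / of_real s"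
  define \<beta> where "\<beta> = - w * \<alpha>"
  define A :: "real^2^2" where "A = vector [vector [Re \<alpha> + Re \<beta>, Im \<alpha> - Im \<beta>],
      vector [- Im \<alpha> - Im \<beta>, Re \<alpha> - Re \<beta>]]"
  have ab: "SU_alpha A = \<alpha>" "SU_beta A = \<beta>"
    by (simp_all add: SU_alpha_def SU_beta_def A_def complex_eq_iff)
  have n: "(norm \<alpha>)\<^sup>2 = 1 / s\<^sup>2" by (simp add: \<alpha>_def norm_divide power_divide)
  have "det A = (norm \<alpha>)\<^sup>2 - (norm \<beta>)\<^sup>2"
    unfolding cmod_power2 by (simp add: det_2 A_def power2_eq_square algebra_simps)
  also have "\<dots> = (norm \<alpha>)\<^sup>2 * (1 - (norm w)\<^sup>2)"
    by (simp add: \<beta>_def norm_mult power_mult_distrib algebra_simps)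
  also have "\<dots> = 1" using s n by (simp flip: s(2))
  finally have det: "det A = 1" .
  have nz: "\<alpha> \<noteq> 0" using s by (simp add: \<alpha>_def)
  have "cnj \<alpha> = exp (- (\<i> * of_real (t / 2))) / of_real s"
    by (simp add: \<alpha>_def exp_cnj)
  then have "\<alpha> / cnj \<alpha> = exp (\<i> * of_real (t / 2)) / exp (- (\<i> * of_real (t / 2)))"
    using s by (simp add: \<alpha>_def)
  also have "\<dots> = exp (\<i> * of_real t)" by (simp flip: exp_diff)
  finally have q: "\<alpha> / cnj \<alpha> = exp (\<i> * of_real t)" .
  have "disk_map A z = Moebius_function t w z" for z
  proof -
    have 1: "\<alpha> * z + \<beta> = \<alpha> * (z - w)" by (simp add: \<beta>_def algebra_simps)
    have 2: "cnj \<beta> * z + cnj \<alpha> = cnj \<alpha> * (1 - cnj w * z)" by (simp add: \<beta>_def algebra_simps)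
    have "disk_map A z = (\<alpha> * (z - w)) / (cnj \<alpha> * (1 - cnj w * z))"
      unfolding disk_map_def ab 1 2 ..
    also have "\<dots> = \<alpha> / cnj \<alpha> * (z - w) / (1 - cnj w * z)" by simp
    finally show ?thesis unfolding Moebius_function_def q .
  qed
  with det show ?thesis by blast
qed

lemma circle_deriv_eq:
  assumes "circle_lift f F" "(F has_real_derivative D) (at \<theta>)"
  shows "circle_deriv f \<theta> = D"
  unfolding circle_deriv_def
proof (rule the_equality)
  have vd: "((\<lambda>t. f (cis t)) has_vector_derivative of_real E * (\<i> * f (cis \<theta>))) (at \<theta>)"
    if "circle_lift f G" "(G has_real_derivative E) (at \<theta>)" for G E
  proof -
    have f: "f (cis t) = exp (\<i> * of_real (G t))" for t
      using that(1) by (simp add: circle_lift_def cis_conv_exp)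
    have "((\<lambda>t. complex_of_real (G t)) has_vector_derivative of_real E) (at \<theta>)"
      using that(2) by (simp add: has_vector_derivative_of_real has_real_derivative_iff_has_vector_derivative)
    then have "((\<lambda>t. \<i> * complex_of_real (G t)) has_vector_derivative \<i> * of_real E) (at \<theta>)"
      by (rule has_vector_derivative_mult_right)
    from field_vector_diff_chain_at[OF this DERIV_exp]
    show ?thesis unfolding f by (simp add: o_def mult_ac)
  qed
  show "\<exists>F. circle_lift f F \<and> (F has_real_derivative D) (at \<theta>)" using assms by blast
  fix E assume "\<exists>G. circle_lift f G \<and> (G has_real_derivative E) (at \<theta>)"
  then have "of_real E * (\<i> * f (cis \<theta>)) = of_real D * (\<i> * f (cis \<theta>))"
    using vd assms vector_derivative_unique_at by blast
  moreover have "f (cis \<theta>) \<noteq> 0" using assms(1) by (simp add: circle_lift_def)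
  ultimately show "E = D" by simp
qed

end

theory Submission
  imports Defs "HOL-Real_Asymp.Real_Asymp"
begin

text \<open>
  If \<open>f\<close> is given by the matrix \<open>(\<alpha> \<beta>; cnj \<beta> cnj \<alpha>)\<close> of determinant 1, then
  \<open>Df(\<theta>) = 1 / \<bar>\<alpha> + \<beta> e\<^sup>-\<^sup>i\<^sup>\<theta>\<bar>\<^sup>2\<close>, and the denominator is
  \<open>\<bar>\<alpha>\<bar>\<^sup>2 + \<bar>\<beta>\<bar>\<^sup>2 - 2 \<bar>\<alpha>\<bar> \<bar>\<beta>\<bar> cos (\<theta> - c)\<close> for some \<open>c\<close>. So \<open>log Df\<close> is monotone on two
  complementary half circles and \<open>var (log Df) = 8 log (\<bar>\<alpha>\<bar> + \<bar>\<beta>\<bar>) = 8 arsinh \<bar>\<beta>\<bar>\<close>. The entry \<open>\<beta>\<close>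
  of the \<open>n\<close>-th power of the matrix is \<open>U\<^sub>n \<beta>\<close>, where \<open>U\<^sub>n\<close> is a Chebyshev polynomial of the second
  kind evaluated at half the trace, \<open>Re \<alpha>\<close>. We may assume
  \<open>Re \<alpha> \<ge> 0\<close>. For \<open>Re \<alpha> \<le> 1\<close> we have \<open>\<bar>U\<^sub>n\<bar> \<le> n\<close>, so the asymptotic
  distortion is 0; for \<open>Re \<alpha> = cosh l > 1\<close> we have \<open>U\<^sub>n = sinh (n l) / sinh l\<close> and \<open>\<beta> \<noteq> 0\<close>, so it
  is \<open>8 l\<close>.
\<close>

section \<open>Total variation of monotone functions of the cosine\<close>

lemma cos_int_pi: "cos (of_int p * pi) = (if even p then 1 else - 1)"
  using cos_npi_int[of p] by (simp add: mult.commute)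

lemma sin_int_pi: "sin (of_int p * pi) = 0"
  using sin_npi_int[of p] by (simp add: mult.commute)

text \<open>Between consecutive multiples of \<open>pi\<close> the cosine is monotone, decreasing
  for even \<open>p\<close> and increasing for odd \<open>p\<close>, so composing it with
  \<open>g\<close> gives increments of a single sign.\<close>

lemma abs_diff_add_mono_cos:
  fixes g :: "real \<Rightarrow> real" and p :: int
  assumes g: "mono_on {-1..1} g"
    and xyz: "of_int p * pi \<le> x" "x \<le> y" "y \<le> z" "z \<le> (of_int p + 1) * pi"
  shows "\<bar>g (cos z) - g (cos x)\<bar> = \<bar>g (cos z) - g (cos y)\<bar> + \<bar>g (cos y) - g (cos x)\<bar>"
proof -
  have cos_shift: "cos t = (if even p then 1 else -1) * cos (t - of_int p * pi)" for t
    by (simp add: cos_diff cos_int_pi sin_int_pi)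
  have le: "cos (z - of_int p * pi) \<le> cos (y - of_int p * pi)"
    "cos (y - of_int p * pi) \<le> cos (x - of_int p * pi)"
    using xyz by (intro cos_monotone_0_pi_le; simp add: algebra_simps)+
  show ?thesis
  proof (cases "even p")
    case True
    then have "cos z \<le> cos y" "cos y \<le> cos x"
      using le by (simp_all add: cos_shift[of x] cos_shift[of y] cos_shift[of z])
    then have "g (cos z) \<le> g (cos y)" "g (cos y) \<le> g (cos x)"
      by (auto intro!: mono_onD[OF g])
    then show ?thesis by linarith
  next
    case False
    then have "cos y \<le> cos z" "cos x \<le> cos y"
      using le by (simp_all add: cos_shift[of x] cos_shift[of y] cos_shift[of z])
    then have "g (cos y) \<le> g (cos z)" "g (cos x) \<le> g (cos y)"
      by (auto intro!: mono_onD[OF g])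
    then show ?thesis by linarith
  qed
qed

text \<open>The subdivision through the extrema of the cosine attains the value. An arbitrary
  subdivision may start anywhere and jump over extrema, so its increments are bounded by those of a
  function \<open>V\<close> on the whole line, which telescope.\<close>

lemma circle_var_mono_cos:
  fixes g :: "real \<Rightarrow> real"
  assumes g: "mono_on {-1..1} g"
  shows "circle_var (\<lambda>\<theta>. g (cos (\<theta> - c))) = ereal (2 * (g 1 - g (-1)))"
proof -
  define M where "M = \<bar>g 1 - g (-1)\<bar>"
  have M: "M = g 1 - g (-1)"
    using mono_onD[OF g, of "-1" 1] by (simp add: M_def)
  \<comment> \<open>\<open>V\<close> is the variation function of \<open>g \<circ> cos\<close>, which is monotone between multiples of \<open>pi\<close>.\<close>
  define V where
    "V x = of_int \<lfloor>x / pi\<rfloor> * M + \<bar>g (cos x) - g (cos (of_int \<lfloor>x / pi\<rfloor> * pi))\<bar>" for x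
  have bounds: "of_int \<lfloor>x / pi\<rfloor> * pi \<le> x" "x \<le> (of_int \<lfloor>x / pi\<rfloor> + 1) * pi" for x
    using floor_divide_lower[of pi x] floor_divide_upper[of pi x] by simp_all
  have nodes: "\<bar>g (cos (of_int q * pi)) - g (cos (of_int p * pi))\<bar> \<le> M" for p q :: int
    by (auto simp: cos_int_pi M_def)
  have node_step: "\<bar>g (cos ((of_int p + 1) * pi)) - g (cos (of_int p * pi))\<bar> = M" for p :: int
  proof -
    have "cos ((of_int p + 1) * pi) = - cos (of_int p * pi)" by (simp add: distrib_right)
    then show ?thesis by (auto simp: cos_int_pi M_def)
  qed
  have V_increment: "\<bar>g (cos y) - g (cos x)\<bar> \<le> V y - V x" if "x \<le> y" for x y
  proof -
    define p q where "p = \<lfloor>x / pi\<rfloor>" "q = \<lfloor>y / pi\<rfloor>"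
    note pq = this
    have pl: "of_int p * pi \<le> x" "x \<le> (of_int p + 1) * pi"
      and ql: "of_int q * pi \<le> y" "y \<le> (of_int q + 1) * pi"
      using bounds by (simp_all add: pq)
    have "p \<le> q" unfolding pq by (intro floor_mono divide_right_mono that) simp
    show ?thesis
    proof (cases "p = q")
      case True
      then show ?thesis
        using abs_diff_add_mono_cos[OF g order_refl pl(1) that] ql
        by (simp add: V_def flip: pq)
    next
      case False
      with \<open>p \<le> q\<close> have "p + 1 \<le> q" by simp
      \<comment> \<open>If at least one half period separates the nodes, a single \<open>M\<close>
        already suffices; otherwise the nodes coincide.\<close>
      have middle: "\<bar>g (cos (of_int q * pi)) - g (cos ((of_int p + 1) * pi))\<bar>
          \<le> (of_int q - of_int p - 1) * M" (is "\<bar>?\<phi>q - ?\<phi>p'\<bar> \<le> _")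
      proof (cases "q = p + 1")
        case False
        then have "p + 2 \<le> q" using \<open>p + 1 \<le> q\<close> by simp
        then have "real_of_int 1 \<le> of_int (q - p - 1)" unfolding of_int_le_iff by simp
        then have "1 * M \<le> (of_int q - of_int p - 1) * M"
          by (intro mult_right_mono) (auto simp: M_def)
        with nodes[of q "p + 1"] show ?thesis by simp
      qed simp
      then have "\<bar>?\<phi>q - ?\<phi>p'\<bar> \<le> of_int q * M - of_int p * M - M"
        by (simp only: left_diff_distrib mult_1)
      \<comment> \<open>Splitting the half period at \<open>x\<close> turns the increment up to the
        next node into \<open>M\<close> minus the increment from the previous node, which is the one
        that \<open>V\<close> records.\<close>
      moreover have "\<bar>?\<phi>p' - g (cos x)\<bar> + \<bar>g (cos x) - g (cos (of_int p * pi))\<bar> = M"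
        using abs_diff_add_mono_cos[OF g order_refl pl order_refl] node_step by simp
      ultimately show ?thesis
        unfolding V_def pq[symmetric] by linarith
    qed
  qed
  have V_period: "V (x + 2 * pi) = V x + 2 * M" for x
  proof -
    have "(x + 2 * pi) / pi = x / pi + of_int 2" by (simp add: field_simps)
    then have fl: "\<lfloor>(x + 2 * pi) / pi\<rfloor> = \<lfloor>x / pi\<rfloor> + 2" by (simp only: floor_add_int)
    have nd: "cos (of_int (\<lfloor>x / pi\<rfloor> + 2) * pi) = cos (of_int \<lfloor>x / pi\<rfloor> * pi)"
      by (simp only: cos_int_pi) simp
    show ?thesis unfolding V_def fl nd cos_periodic by (simp add: distrib_right)
  qed
  show ?thesis
  proof (rule antisym)
    show "circle_var (\<lambda>\<theta>. g (cos (\<theta> - c))) \<le> ereal (2 * (g 1 - g (-1)))"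
      unfolding circle_var_def
    proof (rule SUP_least, clarify)
      fix n :: nat and t :: "nat \<Rightarrow> real"
      assume t: "\<forall>i<n. t i \<le> t (Suc i)" and tn: "t n = t 0 + 2 * pi"
      have "(\<Sum>i<n. \<bar>g (cos (t (Suc i) - c)) - g (cos (t i - c))\<bar>)
          \<le> (\<Sum>i<n. V (t (Suc i) - c) - V (t i - c))"
        using t by (intro sum_mono V_increment) auto
      also have "\<dots> = V (t n - c) - V (t 0 - c)"
        by (rule sum_lessThan_telescope)
      also have "t n - c = (t 0 - c) + 2 * pi" using tn by simp
      finally show "ereal (\<Sum>i<n. \<bar>g (cos (t (Suc i) - c)) - g (cos (t i - c))\<bar>)
          \<le> ereal (2 * (g 1 - g (-1)))"
        unfolding V_period by (simp add: M)
    qed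
    have "ereal (\<Sum>i<2. \<bar>g (cos (c + real (Suc i) * pi - c)) - g (cos (c + real i * pi - c))\<bar>)
        \<le> circle_var (\<lambda>\<theta>. g (cos (\<theta> - c)))"
      unfolding circle_var_def
      by (rule SUP_upper2[where i = "(2, \<lambda>i. c + real i * pi)"]) (auto simp: algebra_simps)
    then show "ereal (2 * (g 1 - g (-1))) \<le> circle_var (\<lambda>\<theta>. g (cos (\<theta> - c)))"
      using M by (simp add: numeral_2_eq_2 M_def)
  qed
qed

section \<open>The derivative of a disk automorphism on the circle\<close>

lemma cis_mult_cis_minus: "cis t * cis (- t) = 1"
  by (simp add: cis_mult)

lemma circle_deriv_disk_automorphism:
  assumes norm: "(norm \<alpha>)\<^sup>2 - (norm \<beta>)\<^sup>2 = 1"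
    and h: "\<And>t. h (cis t) = (\<alpha> * cis t + \<beta>) / (cnj \<beta> * cis t + cnj \<alpha>)"
  shows "circle_deriv h \<theta> = 1 / (norm (\<alpha> + \<beta> * cis (- \<theta>)))\<^sup>2"
proof -
  have "(norm \<beta>)\<^sup>2 < (norm \<alpha>)\<^sup>2" using norm by linarith
  then have lt: "norm \<beta> < norm \<alpha>" by (rule power_less_imp_less_base) simp
  then have \<alpha>: "\<alpha> \<noteq> 0" by auto
  define q where "q = \<beta> / \<alpha>"
  have q: "norm q < 1" using lt \<alpha> by (simp add: q_def norm_divide)
  \<comment> \<open>The curve stays in the right half-plane, so the principal logarithm yields a
    differentiable argument along the whole circle.\<close>
  have Re_pos: "Re (1 + q * cis (- t)) > 0" for t
  proof -
    have "\<bar>Re (q * cis (- t))\<bar> \<le> norm (q * cis (- t))" by (rule abs_Re_le_cmod)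
    also have "\<dots> < 1" using q by (simp add: norm_mult)
    finally show ?thesis by simp
  qed
  then have nonpos: "1 + q * cis (- t) \<notin> \<real>\<^sub>\<le>\<^sub>0" and nz: "1 + q * cis (- t) \<noteq> 0" for t
    by (metis complex_nonpos_Reals_iff not_le, metis less_irrefl zero_complex.sel(1))
  have cis_2Arg: "cis (2 * Im (Ln z)) = z / cnj z" if "z \<noteq> 0" for z
  proof -
    have z: "z = norm z * cis (Im (Ln z))"
      using exp_Ln[OF that] by (metis that exp_eq_polar exp_Ln Re_Ln exp_ln zero_less_norm_iff)
    then have "cnj z = norm z * cis (- Im (Ln z))"
      by (metis cis_cnj complex_cnj_complex_of_real complex_cnj_mult)
    then have "z / cnj z = cis (Im (Ln z)) / cis (- Im (Ln z))"
      using z that by (metis mult_divide_mult_cancel_left norm_eq_zero of_real_eq_0_iff)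
    then show ?thesis by (simp add: cis_divide)
  qed
  \<comment> \<open>On the circle \<open>h z = z v / cnj v\<close> with \<open>v = \<alpha> + \<beta> cnj z = \<alpha> (1 + q cnj z)\<close>, and \<open>v / cnj v\<close> has
    argument \<open>2 Arg v\<close>.\<close>
  define F where "F t = t + 2 * Im (Ln \<alpha>) + 2 * Im (Ln (1 + q * cis (- t)))" for t
  have deriv: "(F has_real_derivative 1 / (norm (\<alpha> + \<beta> * cis (- t)))\<^sup>2) (at t)" for t
  proof -
    define w where "w = q * cis (- t)"
    have "((\<lambda>s. exp (- \<i> * of_real s)) has_vector_derivative - \<i> * exp (- \<i> * of_real t)) (at t)"
    proof -
      have "((\<lambda>s. - \<i> * complex_of_real s) has_vector_derivative - \<i> * of_real 1) (at t)"
        by (intro has_vector_derivative_mult_right has_vector_derivative_of_real)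
           (auto intro: derivative_eq_intros)
      from field_vector_diff_chain_at[OF this DERIV_exp] show ?thesis
        by (simp add: o_def)
    qed
    moreover have "cis (- s) = exp (- \<i> * of_real s)" for s by (simp add: cis_conv_exp)
    ultimately have "((\<lambda>s. cis (- s)) has_vector_derivative - \<i> * cis (- t)) (at t)" by simp
    from has_vector_derivative_mult_right[OF this, of q]
    have "((\<lambda>s. 1 + q * cis (- s)) has_vector_derivative - \<i> * w) (at t)"
      by (simp add: w_def mult_ac add.commute[of 1] has_vector_derivative_add_const)
    moreover have "(Ln has_field_derivative inverse (1 + q * cis (- t))) (at (1 + q * cis (- t)))"
      by (rule has_field_derivative_Ln[OF nonpos])
    ultimately have "((\<lambda>s. Ln (1 + q * cis (- s))) has_vector_derivative
        - \<i> * w * inverse (1 + q * cis (- t))) (at t)"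
      using field_vector_diff_chain_at[of "\<lambda>s. 1 + q * cis (- s)" _ t Ln] unfolding o_def by blast
    from bounded_linear.has_vector_derivative[OF bounded_linear_Im this]
    have "((\<lambda>s. Im (Ln (1 + q * cis (- s)))) has_real_derivative
        Im (- \<i> * w * inverse (1 + q * cis (- t)))) (at t)"
      by (simp add: has_real_derivative_iff_has_vector_derivative)
    then have "(F has_real_derivative (1 + 0 + 2 * Im (- \<i> * w * inverse (1 + q * cis (- t))))) (at t)"
      unfolding F_def[abs_def] by (intro DERIV_add DERIV_ident DERIV_const DERIV_cmult)
    \<comment> \<open>The Poisson kernel appears:
      \<open>1 - 2 Re (w / (1 + w)) = (1 - |w|^2) / |1 + w|^2\<close>, and the determinant condition
      gives \<open>1 - |w|^2 = 1 / |\<alpha>|^2\<close>.\<close>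
    moreover have "1 + 0 + 2 * Im (- \<i> * w * inverse (1 + q * cis (- t)))
        = 1 / (norm (\<alpha> + \<beta> * cis (- t)))\<^sup>2"
    proof -
      have nw: "(norm w)\<^sup>2 = (norm \<beta>)\<^sup>2 / (norm \<alpha>)\<^sup>2"
        by (simp add: w_def norm_mult q_def norm_divide power_divide)
      have w1: "norm (1 + w) \<noteq> 0" using nz[of t] by (simp add: w_def)
      have "\<alpha> + \<beta> * cis (- t) = \<alpha> * (1 + w)"
        using \<alpha> by (simp add: w_def q_def field_simps)
      then have R: "(norm (\<alpha> + \<beta> * cis (- t)))\<^sup>2 = (norm \<alpha>)\<^sup>2 * (norm (1 + w))\<^sup>2"
        by (simp add: norm_mult power_mult_distrib)
      have "Im (- \<i> * w * inverse (1 + w)) = - Re (w * inverse (1 + w))" by simp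
      also have "w * inverse (1 + w) = w * cnj (1 + w) / of_real ((norm (1 + w))\<^sup>2)"
        by (metis divide_inverse complex_div_cnj of_real_power)
      also have "Re (w * cnj (1 + w) / of_real ((norm (1 + w))\<^sup>2))
          = (Re w + (norm w)\<^sup>2) / (norm (1 + w))\<^sup>2"
        unfolding Re_divide_of_real cmod_power2[of w] by (simp add: cmod_power2 power2_eq_square algebra_simps)
      finally have "1 + 0 + 2 * Im (- \<i> * w * inverse (1 + w))
          = ((norm (1 + w))\<^sup>2 - 2 * (Re w + (norm w)\<^sup>2)) / (norm (1 + w))\<^sup>2"
        using w1 by (simp add: field_simps)
      also have "(norm (1 + w))\<^sup>2 - 2 * (Re w + (norm w)\<^sup>2) = 1 - (norm w)\<^sup>2"
        unfolding cmod_power2 by (simp add: power2_eq_square algebra_simps)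
      also have "1 - (norm w)\<^sup>2 = 1 / (norm \<alpha>)\<^sup>2"
      proof -
        have "(norm \<beta>)\<^sup>2 = (norm \<alpha>)\<^sup>2 - 1" using norm by simp
        then show ?thesis unfolding nw using \<alpha> by (simp add: diff_divide_distrib)
      qed
      finally show ?thesis unfolding R by (simp add: w_def)
    qed
    ultimately show ?thesis by simp
  qed
  have "h (cis t) = cis (F t)" for t
  proof -
    have "cis (F t) = cis t * (\<alpha> / cnj \<alpha>) * ((1 + q * cis (- t)) / cnj (1 + q * cis (- t)))"
      unfolding F_def by (simp only: cis_2Arg[OF \<alpha>] cis_2Arg[OF nz] flip: cis_mult)
    also have "\<dots> = cis t * (\<alpha> * (1 + q * cis (- t))) / (cnj (\<alpha> * (1 + q * cis (- t))))"
      by simp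
    also have "\<alpha> * (1 + q * cis (- t)) = \<alpha> + \<beta> * cis (- t)"
      using \<alpha> by (simp add: q_def field_simps)
    also have "cis t * (\<alpha> + \<beta> * cis (- t)) = \<alpha> * cis t + \<beta>"
      using cis_mult_cis_minus[of t] by (simp add: algebra_simps)
    also have "cnj (\<alpha> + \<beta> * cis (- t)) = cnj \<beta> * cis t + cnj \<alpha>"
      by (simp add: cis_cnj)
    finally show ?thesis by (simp add: h)
  qed
  moreover have "continuous_on UNIV F"
    using deriv by (meson DERIV_continuous continuous_at_imp_continuous_on)
  ultimately have "circle_lift h F" by (simp add: circle_lift_def)
  with deriv show ?thesis by (blast intro: circle_deriv_eq)
qed

lemma circle_var_disk_automorphism:
  assumes norm: "(norm \<alpha>)\<^sup>2 - (norm \<beta>)\<^sup>2 = 1"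
    and h: "\<And>t. h (cis t) = (\<alpha> * cis t + \<beta>) / (cnj \<beta> * cis t + cnj \<alpha>)"
  shows "circle_var (\<lambda>\<theta>. ln (circle_deriv h \<theta>)) = ereal (8 * arsinh (norm \<beta>))"
proof -
  define a b where "a = norm \<alpha>" "b = norm \<beta>"
  note ab = this
  have ge: "a \<ge> 0" "b \<ge> 0" by (simp_all add: ab)
  have n: "a\<^sup>2 - b\<^sup>2 = 1" using norm by (simp add: ab)
  then have "b\<^sup>2 < a\<^sup>2" by linarith
  then have lt: "b < a" by (rule power_less_imp_less_base) (use ge in simp)
  \<comment> \<open>The law of cosines produces a plus sign before the cosine; the shift by
    \<open>pi\<close> makes it a minus, so that \<open>g\<close> is increasing. For \<beta> = 0 the
    value of \<open>Arg \<beta>\<close> does not matter because \<open>b = 0\<close>.\<close>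
  define c where "c = Arg \<beta> - Arg \<alpha> + pi"
  define g where "g x = - ln (a\<^sup>2 + b\<^sup>2 - 2 * a * b * x)" for x
  have pos: "a\<^sup>2 + b\<^sup>2 - 2 * a * b * x > 0" if "x \<le> 1" for x
  proof -
    have "a * b * x \<le> a * b * 1" using ge that by (intro mult_left_mono) auto
    moreover have "(a - b)\<^sup>2 > 0" using lt by simp
    ultimately show ?thesis by (simp add: power2_diff)
  qed
  have mono: "mono_on {-1..1} g"
  proof (rule mono_onI)
    fix x y :: real assume "x \<in> {-1..1}" "y \<in> {-1..1}" "x \<le> y"
    moreover from this have "a * b * x \<le> a * b * y" using ge by (intro mult_left_mono) auto
    ultimately show "g x \<le> g y"
      using pos[of x] pos[of y] by (simp add: g_def mult.assoc)
  qed
  have "ln (circle_deriv h \<theta>) = g (cos (\<theta> - c))" for \<theta>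
  proof -
    have "(norm (\<alpha> + \<beta> * cis (- \<theta>)))\<^sup>2 = a\<^sup>2 + b\<^sup>2 - 2 * a * b * cos (\<theta> - c)"
    proof -
      have "\<alpha> = a * cis (Arg \<alpha>)" "\<beta> = b * cis (Arg \<beta>)"
        by (simp_all add: ab rcis_cmod_Arg flip: rcis_def)
      then have "\<alpha> + \<beta> * cis (- \<theta>) = a * cis (Arg \<alpha>) + b * cis (Arg \<beta> - \<theta>)"
        by (metis (no_types, lifting) mult.assoc cis_mult diff_conv_add_uminus)
      moreover have "(norm (a * cis u + b * cis v))\<^sup>2 = a\<^sup>2 + b\<^sup>2 + 2 * a * b * cos (v - u)" for u v
      proof -
        have "(norm (a * cis u + b * cis v))\<^sup>2 = a\<^sup>2 * ((sin u)\<^sup>2 + (cos u)\<^sup>2)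
            + b\<^sup>2 * ((sin v)\<^sup>2 + (cos v)\<^sup>2) + 2 * a * b * cos (v - u)"
          unfolding cmod_power2 cos_diff
          by (simp add: power2_eq_square algebra_simps del: sin_cos_squared_add sin_cos_squared_add2
              sin_cos_squared_add3)
        then show ?thesis by simp
      qed
      moreover have "cos (Arg \<beta> - \<theta> - Arg \<alpha>) = - cos (\<theta> - c)"
      proof -
        have "cos (\<theta> - c) = cos (c - \<theta>)" by (metis cos_minus minus_diff_eq)
        also have "c - \<theta> = (Arg \<beta> - \<theta> - Arg \<alpha>) + pi" by (simp add: c_def)
        finally show ?thesis by simp
      qed
      ultimately show ?thesis by simp
    qed
    then show ?thesis
      using pos[of "cos (\<theta> - c)"]
      by (simp add: circle_deriv_disk_automorphism[OF assms] g_def ln_div)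
  qed
  then have "circle_var (\<lambda>\<theta>. ln (circle_deriv h \<theta>)) = ereal (2 * (g 1 - g (-1)))"
    by (simp add: circle_var_mono_cos[OF mono])
  also have "2 * (g 1 - g (-1)) = 8 * arsinh b"
  proof -
    have "a = sqrt (b\<^sup>2 + 1)"
      using n ge by (intro real_sqrt_unique[symmetric]) auto
    then have arsinh: "arsinh b = ln (a + b)" by (simp add: arsinh_real_def add.commute)
    have "g (-1) = - ln ((a + b)\<^sup>2)" by (simp add: g_def power2_sum)
    also have "\<dots> = - 2 * ln (a + b)" using lt ge by (simp add: ln_realpow)
    finally have g1: "g (-1) = - 2 * ln (a + b)" .
    \<comment> \<open>The extreme values \<open>a - b\<close> and \<open>a + b\<close> of the
      modulus are reciprocal, hence \<open>g 1 = - g (-1)\<close>.\<close>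
    have "(a - b) * (a + b) = 1" using n by (simp add: power2_eq_square algebra_simps)
    then have "a - b = 1 / (a + b)" using lt ge by (simp add: field_simps)
    moreover have "g 1 = - ln ((a - b)\<^sup>2)" by (simp add: g_def power2_diff)
    ultimately have "g 1 = 2 * ln (a + b)" using lt ge by (simp add: ln_realpow ln_div)
    with g1 arsinh show ?thesis by simp
  qed
  finally show ?thesis by (simp add: ab)
qed

section \<open>Iterates\<close>

text \<open>The index is shifted by one: this is \<open>U\<^sub>n\<^sub>-\<^sub>1\<close> in the usual numbering.\<close>

fun chebyshev_U :: "real \<Rightarrow> nat \<Rightarrow> real" where
  "chebyshev_U x 0 = 0"
| "chebyshev_U x (Suc 0) = 1"
| "chebyshev_U x (Suc (Suc n)) = 2 * x * chebyshev_U x (Suc n) - chebyshev_U x n"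

text \<open>The recursion preserves this quadratic form. It controls the growth for
  \<open>\<bar>x\<bar> \<le> 1\<close> and gives determinant 1 for the iterates.\<close>

lemma chebyshev_U_quadratic:
  "(chebyshev_U x (Suc n))\<^sup>2 - 2 * x * chebyshev_U x (Suc n) * chebyshev_U x n
    + (chebyshev_U x n)\<^sup>2 = 1"
proof (induction n)
  case (Suc n)
  then show ?case by (simp add: power2_eq_square algebra_simps)
qed simp

text \<open>Completing the square in the quadratic identity bounds \<open>?v - x * ?u\<close> by 1,
  so the absolute value grows by at most 1 per step.\<close>

lemma abs_chebyshev_U_le:
  assumes "\<bar>x\<bar> \<le> 1"
  shows "\<bar>chebyshev_U x n\<bar> \<le> real n"
proof (induction n)
  case (Suc n)
  let ?u = "chebyshev_U x n" and ?v = "chebyshev_U x (Suc n)"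
  have "x\<^sup>2 \<le> 1" using assms by (simp add: abs_square_le_1)
  then have "(1 - x\<^sup>2) * ?u\<^sup>2 \<ge> 0" by simp
  moreover have "(?v - x * ?u)\<^sup>2 = 1 - (1 - x\<^sup>2) * ?u\<^sup>2"
    using chebyshev_U_quadratic[of x n] by (simp add: power2_eq_square algebra_simps)
  ultimately have "\<bar>?v - x * ?u\<bar> \<le> 1" by (simp add: abs_square_le_1[symmetric])
  moreover have "\<bar>x * ?u\<bar> \<le> \<bar>?u\<bar>"
    using mult_right_mono[OF assms, of "\<bar>?u\<bar>"] by (simp add: abs_mult)
  ultimately show ?case using Suc by linarith
qed simp

text \<open>Adding the expansions of \<open>sinh (y + l)\<close> and \<open>sinh (y - l)\<close>
  gives the recursion with \<open>x = cosh l\<close>.\<close>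

lemma chebyshev_U_cosh:
  assumes "l \<noteq> 0"
  shows "chebyshev_U (cosh l) n = sinh (real n * l) / sinh l"
proof (induction "cosh l" n rule: chebyshev_U.induct)
  case (3 n)
  have "sinh (real (Suc (Suc n)) * l) = sinh (real (Suc n) * l + l)"
    by (simp add: algebra_simps)
  moreover have "sinh (real n * l) = sinh (real (Suc n) * l - l)"
    by (simp add: algebra_simps)
  ultimately have "sinh (real (Suc (Suc n)) * l)
      = 2 * cosh l * sinh (real (Suc n) * l) - sinh (real n * l)"
    by (simp only: sinh_add sinh_diff) (simp add: algebra_simps)
  with 3 show ?case by (simp add: diff_divide_distrib)
qed (use assms in auto)

text \<open>
  By the Cayley-Hamilton theorem, the \<open>n\<close>-th power of a matrix \<open>A\<close> of determinant 1 is
  \<open>U\<^sub>n A - U\<^sub>n\<^sub>-\<^sub>1\<close>, where \<open>U\<^sub>n\<close> is \<open>chebyshev_U\<close> at half the trace; the top left entry \<open>\<alpha>'\<close> below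
  is \<open>U\<^sub>n \<alpha> - U\<^sub>n\<^sub>-\<^sub>1\<close>, written so that it makes sense for \<open>n = 0\<close>.
\<close>

lemma disk_automorphism_iterate:
  fixes \<alpha> \<beta> :: complex
  defines "u \<equiv> chebyshev_U (Re \<alpha>)"
  defines "\<alpha>' \<equiv> \<lambda>n. of_real (u (Suc n)) - of_real (u n) * cnj \<alpha>"
    and "\<beta>' \<equiv> \<lambda>n. of_real (u n) * \<beta>"
  assumes norm: "(norm \<alpha>)\<^sup>2 - (norm \<beta>)\<^sup>2 = 1"
    and h: "\<And>t. h (cis t) = (\<alpha> * cis t + \<beta>) / (cnj \<beta> * cis t + cnj \<alpha>)"
  shows "(norm (\<alpha>' n))\<^sup>2 - (norm (\<beta>' n))\<^sup>2 = 1"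
    and "(h ^^ n) (cis t) = (\<alpha>' n * cis t + \<beta>' n) / (cnj (\<beta>' n) * cis t + cnj (\<alpha>' n))"
proof -
  have det: "(norm (\<alpha>' n))\<^sup>2 - (norm (\<beta>' n))\<^sup>2 = 1" for n
  proof -
    have "(norm (\<alpha>' n))\<^sup>2 - (norm (\<beta>' n))\<^sup>2
        = (u (Suc n))\<^sup>2 - 2 * Re \<alpha> * u (Suc n) * u n + (u n)\<^sup>2 * ((norm \<alpha>)\<^sup>2 - (norm \<beta>)\<^sup>2)"
      unfolding cmod_power2 \<alpha>'_def \<beta>'_def by (simp add: power2_eq_square algebra_simps)
    then show ?thesis
      using chebyshev_U_quadratic[of "Re \<alpha>" n] by (simp add: norm u_def)
  qed
  then show "(norm (\<alpha>' n))\<^sup>2 - (norm (\<beta>' n))\<^sup>2 = 1" .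
  have den: "cnj (\<beta>' n) * cis t + cnj (\<alpha>' n) \<noteq> 0" for n
  proof
    assume "cnj (\<beta>' n) * cis t + cnj (\<alpha>' n) = 0"
    then have "cnj (\<alpha>' n) = - (cnj (\<beta>' n) * cis t)" by (simp add: eq_neg_iff_add_eq_0 add.commute)
    then have "norm (cnj (\<alpha>' n)) = norm (cnj (\<beta>' n) * cis t)" by simp
    then have "norm (\<alpha>' n) = norm (\<beta>' n)" by (simp add: norm_mult)
    with det[of n] show False by simp
  qed
  have sum_cnj: "\<alpha> + cnj \<alpha> = of_real (2 * Re \<alpha>)" by (rule complex_add_cnj)
  have prod_cnj: "\<beta> * cnj \<beta> = \<alpha> * cnj \<alpha> - 1"
    using norm by (simp add: complex_norm_square[symmetric] flip: of_real_diff of_real_power)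
      (smt (verit) of_real_1 of_real_diff)
  have u_step: "complex_of_real (u (Suc (Suc n))) = (\<alpha> + cnj \<alpha>) * of_real (u (Suc n)) - of_real (u n)" for n
    unfolding sum_cnj by (simp add: u_def)
  have \<alpha>_step: "\<alpha> * \<alpha>' n + \<beta> * cnj (\<beta>' n) = \<alpha>' (Suc n)" for n
  proof -
    have "\<alpha> * \<alpha>' n + \<beta> * cnj (\<beta>' n)
        = of_real (u (Suc n)) * \<alpha> - of_real (u n) * (\<alpha> * cnj \<alpha>) + of_real (u n) * (\<beta> * cnj \<beta>)"
      by (simp add: \<alpha>'_def \<beta>'_def algebra_simps)
    also have "\<dots> = \<alpha>' (Suc n)"
      unfolding prod_cnj \<alpha>'_def u_step by (simp add: algebra_simps)
    finally show ?thesis .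
  qed
  have \<beta>_step: "\<alpha> * \<beta>' n + \<beta> * cnj (\<alpha>' n) = \<beta>' (Suc n)" for n
    by (simp add: \<alpha>'_def \<beta>'_def algebra_simps)
  show "(h ^^ n) (cis t) = (\<alpha>' n * cis t + \<beta>' n) / (cnj (\<beta>' n) * cis t + cnj (\<alpha>' n))"
  proof (induction n)
    case 0
    then show ?case by (simp add: \<alpha>'_def \<beta>'_def u_def)
  next
    case (Suc n)
    define N D where "N = \<alpha>' n * cis t + \<beta>' n" "D = cnj (\<beta>' n) * cis t + cnj (\<alpha>' n)"
    note ND = this
    have D: "D \<noteq> 0" using den by (simp add: ND)
    \<comment> \<open>The formula for \<open>h\<close> is available on the unit circle only, so the
      previous iterate must be written as some \<open>cis s\<close>.\<close>
    have "D = cis t * cnj N"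
      using cis_mult_cis_minus[of t] by (simp add: ND cis_cnj algebra_simps)
    then have "norm (N / D) = 1" using D by (simp add: norm_divide norm_mult)
    then obtain s where s: "N / D = cis s" by (metis cis_Arg_unique complex_norm_eq_1_exp cis_conv_exp)
    have "(h ^^ Suc n) (cis t) = h (cis s)"
      using Suc s by (simp add: ND)
    also have "\<dots> = (\<alpha> * (N / D) + \<beta>) / (cnj \<beta> * (N / D) + cnj \<alpha>)" by (simp add: h s)
    also have "\<dots> = ((\<alpha> * (N / D) + \<beta>) * D) / ((cnj \<beta> * (N / D) + cnj \<alpha>) * D)"
      using D by simp
    also have "(\<alpha> * (N / D) + \<beta>) * D = \<alpha> * N + \<beta> * D"
      using D by (simp add: distrib_right)
    also have "(cnj \<beta> * (N / D) + cnj \<alpha>) * D = cnj \<beta> * N + cnj \<alpha> * D"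
      using D by (simp add: distrib_right)
    also have "\<alpha> * N + \<beta> * D = \<alpha>' (Suc n) * cis t + \<beta>' (Suc n)"
      by (simp add: ND flip: \<alpha>_step \<beta>_step) (simp add: algebra_simps)
    also have "cnj \<beta> * N + cnj \<alpha> * D = cnj (\<beta>' (Suc n)) * cis t + cnj (\<alpha>' (Suc n))"
      by (simp add: ND flip: \<alpha>_step \<beta>_step) (simp add: algebra_simps)
    finally show ?case .
  qed
qed

section \<open>Asymptotic distortion\<close>

lemma dist_infty_eqI:
  assumes norm: "(norm \<alpha>)\<^sup>2 - (norm \<beta>)\<^sup>2 = 1"
    and h: "\<And>t. h (cis t) = (\<alpha> * cis t + \<beta>) / (cnj \<beta> * cis t + cnj \<alpha>)"
    and lim: "(\<lambda>n. 8 * arsinh (\<bar>chebyshev_U (Re \<alpha>) n\<bar> * norm \<beta>) / real n) \<longlonglongrightarrow> L"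
  shows "dist_infty h = ereal L"
proof -
  have var: "circle_var (\<lambda>\<theta>. ln (circle_deriv (h ^^ n) \<theta>))
      = ereal (8 * arsinh (\<bar>chebyshev_U (Re \<alpha>) n\<bar> * norm \<beta>))" for n
    using circle_var_disk_automorphism[OF disk_automorphism_iterate[OF norm h]]
    by (simp add: norm_mult)
  have "(\<lambda>n. circle_var (\<lambda>\<theta>. ln (circle_deriv (h ^^ n) \<theta>)) / ereal (real n)) \<longlonglongrightarrow> ereal L"
  proof (rule Lim_transform_eventually)
    show "(\<lambda>n. ereal (8 * arsinh (\<bar>chebyshev_U (Re \<alpha>) n\<bar> * norm \<beta>) / real n)) \<longlonglongrightarrow> ereal L"
      using lim by simp
    show "\<forall>\<^sub>F n in sequentially. ereal (8 * arsinh (\<bar>chebyshev_U (Re \<alpha>) n\<bar> * norm \<beta>) / real n)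
        = circle_var (\<lambda>\<theta>. ln (circle_deriv (h ^^ n) \<theta>)) / ereal (real n)"
      using eventually_gt_at_top[of 0] by eventually_elim (simp add: var)
  qed
  then show ?thesis unfolding dist_infty_def by (rule limI)
qed

text \<open>The argument grows at most linearly and \<open>arsinh\<close> logarithmically. Bounding
  with \<open>b + 1\<close> keeps the coefficient of \<open>n\<close> positive even for
  \<open>b = 0\<close>.\<close>

lemma arsinh_chebyshev_U_tendsto_0:
  assumes "\<bar>x\<bar> \<le> 1" "b \<ge> 0"
  shows "(\<lambda>n. 8 * arsinh (\<bar>chebyshev_U x n\<bar> * b) / real n) \<longlonglongrightarrow> 0"
proof (rule tendsto_sandwich)
  show "\<forall>\<^sub>F n in sequentially. 8 * arsinh (\<bar>chebyshev_U x n\<bar> * b) / real n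
      \<le> 8 * arsinh (real n * (b + 1)) / real n"
  proof (intro always_eventually allI divide_right_mono mult_left_mono)
    fix n
    have "\<bar>chebyshev_U x n\<bar> * b \<le> real n * (b + 1)"
      using abs_chebyshev_U_le[OF assms(1), of n] assms(2) by (intro mult_mono) auto
    then show "arsinh (\<bar>chebyshev_U x n\<bar> * b) \<le> arsinh (real n * (b + 1))"
      by (simp flip: not_less)
  qed auto
  have "0 \<le> arsinh (\<bar>chebyshev_U x n\<bar> * b)" for n
    using assms(2) arsinh_real_neg_iff[of "\<bar>chebyshev_U x n\<bar> * b"]
    by (simp add: not_less[symmetric] del: arsinh_real_neg_iff) (simp add: not_less)
  then show "\<forall>\<^sub>F n in sequentially. 0 \<le> 8 * arsinh (\<bar>chebyshev_U x n\<bar> * b) / real n"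
    by (intro always_eventually allI divide_nonneg_nonneg) simp_all
  have "b + 1 > 0" using assms(2) by simp
  then show "(\<lambda>n. 8 * arsinh (real n * (b + 1)) / real n) \<longlonglongrightarrow> 0"
    unfolding arsinh_real_def by real_asymp
qed simp

text \<open>For \<open>k > 0\<close>, \<open>arsinh (k * sinh (n * l))\<close> is
  \<open>n * l + ln k + o(1)\<close>, so the factor \<open>k\<close> disappears in the
  limit.\<close>

lemma arsinh_chebyshev_U_cosh_tendsto:
  assumes "l > 0" "b > 0"
  shows "(\<lambda>n. 8 * arsinh (\<bar>chebyshev_U (cosh l) n\<bar> * b) / real n) \<longlonglongrightarrow> 8 * l"
proof -
  define k where "k = b / sinh l"
  have "k > 0" using assms by (simp add: k_def)
  then have "(\<lambda>n. 8 * arsinh (k * sinh (real n * l)) / real n) \<longlonglongrightarrow> 8 * l"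
    using assms(1) unfolding arsinh_real_def sinh_field_def by real_asymp
  moreover have "\<bar>chebyshev_U (cosh l) n\<bar> * b = k * sinh (real n * l)" for n
    using assms by (simp add: chebyshev_U_cosh k_def)
  ultimately show ?thesis by simp
qed

theorem proposition3p4:
  fixes f :: "(real^2^2) set"
  assumes "f \<in> carrier PSL2R"
  shows "dist_infty (psl_action f) > 0 \<longleftrightarrow> hyperbolic f"
proof -
  obtain A where A: "f = {A, - A}" "det A = 1" "trace A \<ge> 0"
  proof -
    obtain B :: "real^2^2" where B: "f = {B, - B}" "det B = 1"
      using assms by (auto simp: carrier_PSL2R)
    show ?thesis
    proof (cases "trace B \<ge> 0")
      case True
      with B that show ?thesis by blast
    next
      case False
      then have "trace (- B) \<ge> 0" by (simp add: trace_def sum_2)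
      with B that[of "- B"] show ?thesis by (simp add: det_minus_2 insert_commute)
    qed
  qed
  define \<alpha> \<beta> where "\<alpha> = SU_alpha A" "\<beta> = SU_beta A"
  note ab = this
  have norm: "(norm \<alpha>)\<^sup>2 - (norm \<beta>)\<^sup>2 = 1" using SU_norm[OF A(2)] by (simp add: ab)
  have h: "psl_action f (cis t) = (\<alpha> * cis t + \<beta>) / (cnj \<beta> * cis t + cnj \<alpha>)" for t
    by (simp add: A(1) psl_action_eq disk_map_def ab)
  have Re: "Re \<alpha> = trace A / 2" by (simp add: ab SU_alpha_def trace_def sum_2)
  have hyp: "hyperbolic f \<longleftrightarrow> Re \<alpha> > 1"
    using A by (simp add: hyperbolic_iff Re)
  show ?thesis
  proof (cases "Re \<alpha> > 1")
    case True
    define l where "l = arcosh (Re \<alpha>)"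
    have l: "l > 0" "Re \<alpha> = cosh l"
      using True by (simp_all add: l_def)
    \<comment> \<open>A hyperbolic element is not a rotation: \<beta> = 0 would force \<alpha> to
      have modulus 1.\<close>
    have "1 < \<bar>Re \<alpha>\<bar>" using True by simp
    also have "\<dots> \<le> norm \<alpha>" by (rule abs_Re_le_cmod)
    finally have "(norm \<alpha>)\<^sup>2 > 1" by (simp add: one_less_power)
    then have "\<beta> \<noteq> 0" using norm by auto
    then have "dist_infty (psl_action f) = ereal (8 * l)"
      using dist_infty_eqI[OF norm h] arsinh_chebyshev_U_cosh_tendsto[OF l(1)] l(2) by simp
    with l True hyp show ?thesis by simp
  next
    case False
    then have "\<bar>Re \<alpha>\<bar> \<le> 1" using A(3) Re by simp
    then have "dist_infty (psl_action f) = ereal 0"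
      using dist_infty_eqI[OF norm h] arsinh_chebyshev_U_tendsto_0 by simp
    with False hyp show ?thesis by simp
  qed
qed

end
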